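(* Let $\langle(p^{(t)},c_t,a_t)\mid t\in\mathbb{N}^0\rangle$ be a strictly alternating LDO-LC problem satisfying $\min\{c_t,\,c_t+a_tb\}>0$ for all $t\in\mathbb{N}^0$, let $x\in X$, and let $\langle y_t\mid t\in\mathbb{N}^0\rangle\in\mathcal{S}^0(x)$. Then: (i) If $p^{(1)}>0$ and $a_{2t}\le 0$ for all $t\in\mathbb{N}$, then $y_{2t}=0$ for all $t\in\mathbb{N}$, $y_1=\min\{c_0+a_0x,\,b\}$, and $y_{2t-1}=\min\{c_{2t-2},\,b\}$ for all $t>1$. (ii) If $p^{(1)}<0$ and $a_{2t-1}\le 0$ for all $t\in\mathbb{N}$, then for all $t\in\mathbb{N}$, $y_{2t}=\min\{c_{2t-1},\,b\}$ and $y_{2t-1}=0$.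
   Context: $\mathbb{N}$ is the set of strictly positive integers and $\mathbb{N}^0=\mathbb{N}\cup\{0\}$. Fix a real number $b>0$ and let $X=[0,b]\subset\mathbb{R}$. A linear dynamic optimization problem with linear constraints (LDO-LC problem) $\langle(p^{(t)},c_t,a_t)\mid t\in\mathbb{N}^0\rangle$ is given by real sequences with $c_t\ge 0$ and $c_t+a_tb\ge 0$ for all $t\in\mathbb{N}^0$, $\sum_{t=0}^\infty|c_t|<+\infty$, $\sum_{t=0}^\infty|a_t|<+\infty$ and $\sum_{t=0}^\infty|p^{(t)}|<+\infty$. For $t\in\mathbb{N}^0$ and $x\in X$, let $\Omega_t(x)=\{y\in[0,b]\mid y\le c_t+a_tx\}=[0,\min\{c_t+a_tx,b\}]$. For $x\in X$, $\mathcal{F}(x)=\mathcal{F}^0(x)$ is the set of all sequences $\langle x_t\mid t\in\mathbb{N}^0\rangle$ in $X$ with $x_0=x$ and $x_{t+1}\in\Omega_t(x_t)$ for all $t\in\mathbb{N}^0$, and $\mathcal{S}^0(x)=\operatorname{argmax}_{\langle x_t\mid t\in\mathbb{N}^0\rangle\in\mathcal{F}(x)}\sum_{t=0}^\infty p^{(t)}x_t$ is the set of optimal trajectories beginning at $x$. An LDO-LC problem is strictly alternating if $p^{(1)}\ne 0$ and for all $t\in\mathbb{N}$: $p^{(t)}\ge 0$ implies $p^{(t+1)}<0$, and $p^{(t)}\le 0$ implies $p^{(t+1)}>0$. *)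

theory Defs
  imports Complex_Main
begin

text \<open>A sequence indexed by the nonnegative integers is a function on \<^typ>\<open>nat\<close>. The state
  space is the real interval from 0 to b, and the index range of the positive integers is
  expressed by the guard \<open>t \<ge> 1\<close>.\<close>

definition ldo_lc :: "real \<Rightarrow> (nat \<Rightarrow> real) \<Rightarrow> (nat \<Rightarrow> real) \<Rightarrow> (nat \<Rightarrow> real) \<Rightarrow> bool" where
  "ldo_lc b p c a \<longleftrightarrow>
     b > 0 \<and>
     (\<forall>t. c t \<ge> 0 \<and> c t + a t * b \<ge> 0) \<and>
     summable (\<lambda>t. \<bar>c t\<bar>) \<and> summable (\<lambda>t. \<bar>a t\<bar>) \<and> summable (\<lambda>t. \<bar>p t\<bar>)"

definition Omega :: "real \<Rightarrow> (nat \<Rightarrow> real) \<Rightarrow> (nat \<Rightarrow> real) \<Rightarrow> nat \<Rightarrow> real \<Rightarrow> real set" where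
  "Omega b c a t x = {y \<in> {0..b}. y \<le> c t + a t * x}"

definition feasible ::
  "real \<Rightarrow> (nat \<Rightarrow> real) \<Rightarrow> (nat \<Rightarrow> real) \<Rightarrow> real \<Rightarrow> (nat \<Rightarrow> real) set" where
  "feasible b c a x =
     {y. (\<forall>t. y t \<in> {0..b}) \<and> y 0 = x \<and> (\<forall>t. y (Suc t) \<in> Omega b c a t (y t))}"

text \<open>For an \<^const>\<open>ldo_lc\<close> problem the objective series converges absolutely on every feasible
  trajectory, since p is absolutely summable and trajectories are bounded; so \<^const>\<open>suminf\<close>
  is the genuine sum.\<close>

definition optimal_trajectories ::
  "real \<Rightarrow> (nat \<Rightarrow> real) \<Rightarrow> (nat \<Rightarrow> real) \<Rightarrow> (nat \<Rightarrow> real) \<Rightarrow> real \<Rightarrow> (nat \<Rightarrow> real) set" where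
  "optimal_trajectories b p c a x =
     {y. is_arg_max (\<lambda>z. \<Sum>t. p t * z t) (\<lambda>z. z \<in> feasible b c a x) y}"

definition strictly_alternating :: "(nat \<Rightarrow> real) \<Rightarrow> bool" where
  "strictly_alternating p \<longleftrightarrow>
     p 1 \<noteq> 0 \<and>
     (\<forall>t\<ge>1. (p t \<ge> 0 \<longrightarrow> p (Suc t) < 0) \<and> (p t \<le> 0 \<longrightarrow> p (Suc t) > 0))"

end

theory Submission
  imports Defs
begin

text \<open>Consider the bang-bang trajectory that moves to 0 before each negative price and as high as
  the constraint allows before each positive one. Signs alternate, so a positive price at time
  n + 1 > 1 is preceded by the state 0; since a n \<le> 0 there, no feasible trajectory can be
  higher at time n + 1. Hence the bang-bang trajectory beats every feasible one term by term,
  and an optimal one must agree with it wherever the price is nonzero.\<close>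

lemma affine_nonneg_on_interval:
  fixes b c a u :: real
  assumes "c \<ge> 0" "c + a * b \<ge> 0" "0 \<le> u" "u \<le> b"
  shows "c + a * u \<ge> 0"
proof (cases "a \<ge> 0")
  case True
  then show ?thesis using assms by simp
next
  case False
  then have "a * b \<le> a * u" using assms by (intro mult_left_mono_neg) auto
  then show ?thesis using assms by linarith
qed

lemma summable_mult_bounded:
  fixes p z :: "nat \<Rightarrow> real"
  assumes "summable (\<lambda>t. \<bar>p t\<bar>)" and "\<And>t. \<bar>z t\<bar> \<le> b"
  shows "summable (\<lambda>t. p t * z t)"
proof (rule summable_comparison_test')
  show "summable (\<lambda>t. \<bar>p t\<bar> * b)" using assms(1) by (rule summable_mult2)
  show "norm (p t * z t) \<le> \<bar>p t\<bar> * b" for t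
    using assms(2)[of t] by (simp add: abs_mult mult_left_mono)
qed

text \<open>The differences \<open>p t * z t - p t * y t\<close> are nonnegative and summable.
  Optimality of \<open>y\<close> bounds their sum by 0, so each of them vanishes.\<close>

lemma optimal_eq_dominating:
  assumes p: "summable (\<lambda>t. \<bar>p t\<bar>)"
    and y: "y \<in> optimal_trajectories b p c a x"
    and z: "z \<in> feasible b c a x"
    and le: "\<And>t. p t * y t \<le> p t * z t"
  shows "p t * y t = p t * z t"
proof -
  have yf: "y \<in> feasible b c a x"
    and max: "\<not> (\<Sum>t. p t * y t) < (\<Sum>t. p t * z t)"
    using y z by (auto simp: optimal_trajectories_def is_arg_max_def)
  have sm: "summable (\<lambda>t. p t * w t)" if "w \<in> feasible b c a x" for w
    using that by (intro summable_mult_bounded[OF p, of _ b]) (auto simp: feasible_def)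
  have nn: "0 \<le> p t * z t - p t * y t" for t
    using le[of t] by simp
  have sd: "summable (\<lambda>t. p t * z t - p t * y t)"
    by (intro summable_diff sm z yf)
  have "(\<Sum>t. p t * z t - p t * y t) \<le> 0"
    using max suminf_diff[OF sm[OF z] sm[OF yf]] by simp
  then have "(\<Sum>t. p t * z t - p t * y t) = 0"
    using suminf_nonneg[OF sd nn] by simp
  then show ?thesis
    using suminf_eq_zero_iff[OF sd nn] by (metis eq_iff_diff_eq_0)
qed

text \<open>Every real is \<ge> 0 or \<le> 0, so each price from index 1 on forces a strict sign on
  its successor; index 1 itself is covered by the definition.\<close>

lemma strictly_alternating_nonzero:
  assumes "strictly_alternating p" "t \<ge> 1"
  shows "p t \<noteq> 0"
proof (cases "t = 1")
  case False
  then obtain s where "t = Suc s" "s \<ge> 1"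
    using assms(2) by (cases t) auto
  then show ?thesis
    using assms(1) unfolding strictly_alternating_def
    by (cases "p s \<ge> 0") (auto dest!: spec[of _ s])
qed (use assms in \<open>simp add: strictly_alternating_def\<close>)

text \<open>The sign flips at every step from index 1 on, so it depends only on parity. The indices
  are written as successors to match the recursion of \<open>bang_bang\<close>; \<open>p 0\<close>
  is left out, being unconstrained.\<close>

lemma strictly_alternating_signs:
  assumes "strictly_alternating p"
  shows "0 < p (Suc (2 * k)) \<longleftrightarrow> 0 < p 1"
    and "0 < p (Suc (Suc (2 * k))) \<longleftrightarrow> p 1 < 0"
proof -
  have flip: "0 < p (Suc t) \<longleftrightarrow> p t < 0" if "t \<ge> 1" for t
    using assms that unfolding strictly_alternating_def
    by (cases "p t \<ge> 0") (auto dest!: spec[of _ t])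
  show odd: "0 < p (Suc (2 * k)) \<longleftrightarrow> 0 < p 1" for k
  proof (induction k)
    case (Suc k)
    then show ?case
      using flip[of "Suc (2 * k)"] flip[of "Suc (Suc (2 * k))"]
        strictly_alternating_nonzero[OF assms, of "Suc (2 * k)"]
        strictly_alternating_nonzero[OF assms, of "Suc (Suc (2 * k))"] by auto
  qed simp
  show "0 < p (Suc (Suc (2 * k))) \<longleftrightarrow> p 1 < 0"
    using flip[of "Suc (2 * k)"] odd[of k]
      strictly_alternating_nonzero[OF assms, of "Suc (2 * k)"]
      strictly_alternating_nonzero[OF assms, of 1] by auto
qed

text \<open>The previous state enters as \<open>if n = 0 then x else 0\<close> instead of a
  recursive call: under strict alternation a positive price at \<open>Suc n\<close> with
  \<open>n\<close> \<ge> 1 follows a negative one, so the state at \<open>n\<close> is 0. All values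
  are thus explicit.\<close>

fun bang_bang ::
  "real \<Rightarrow> (nat \<Rightarrow> real) \<Rightarrow> (nat \<Rightarrow> real) \<Rightarrow> (nat \<Rightarrow> real) \<Rightarrow> real \<Rightarrow> nat \<Rightarrow> real" where
  "bang_bang b p c a x 0 = x"
| "bang_bang b p c a x (Suc n) =
     (if 0 < p (Suc n) then min (c n + a n * (if n = 0 then x else 0)) b else 0)"

lemma bang_bang_feasible:
  assumes ldo: "ldo_lc b p c a" and alt: "strictly_alternating p" and x: "x \<in> {0..b}"
  shows "bang_bang b p c a x \<in> feasible b c a x"
proof -
  let ?z = "bang_bang b p c a x"
  have b: "b > 0" and c: "c t \<ge> 0" and cab: "c t + a t * b \<ge> 0" for t
    using ldo by (auto simp: ldo_lc_def)
  have nonneg: "c t + a t * u \<ge> 0" if "u \<in> {0..b}" for t u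
    using affine_nonneg_on_interval[OF c cab] that by auto
  have range: "?z t \<in> {0..b}" for t
    \<comment> \<open>For \<open>t\<close> \<ge> 2 a nonzero value is
      \<open>min (c (t - 1)) b\<close>; at \<open>t = 1\<close> the bound still depends on
      \<open>x\<close>.\<close>
    using x b c[of "t - 1"] nonneg[OF x, of 0] by (cases t) auto
  have "?z (Suc n) \<le> c n + a n * ?z n" for n
  proof (cases "0 < p (Suc n)")
    case pos: True
    show ?thesis
    proof (cases n)
      case (Suc m)
      \<comment> \<open>Two consecutive positive prices are excluded, so the trajectory is at 0 at
        time \<open>n\<close> and the closed form agrees with the true constraint.\<close>
      then have "\<not> 0 < p n"
        using alt pos unfolding strictly_alternating_def
        by (metis le_add1 less_imp_le not_less_iff_gr_or_eq plus_1_eq_Suc)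
      then show ?thesis using pos Suc by simp
    qed (use pos in simp)
  next
    case False
    then show ?thesis using nonneg[OF range, of n n] by simp
  qed
  then show ?thesis
    using range by (auto simp: feasible_def Omega_def simp del: bang_bang.simps(2))
qed

text \<open>The sign condition on \<open>a\<close> starts at \<open>n = 1\<close> because at time 0
  all feasible trajectories share the state \<open>x\<close>.\<close>

lemma bang_bang_dominates:
  assumes y: "y \<in> feasible b c a x"
    and a: "\<And>n. n \<ge> 1 \<Longrightarrow> 0 < p (Suc n) \<Longrightarrow> a n \<le> 0"
  shows "p t * y t \<le> p t * bang_bang b p c a x t"
proof (cases t)
  case 0
  then show ?thesis using y by (simp add: feasible_def)
next
  case (Suc n)
  have y0: "y 0 = x" and yn: "0 \<le> y n" "0 \<le> y (Suc n)" "y (Suc n) \<le> b"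
    and step: "y (Suc n) \<le> c n + a n * y n"
    using y by (auto simp: feasible_def Omega_def)
  show ?thesis
  proof (cases "0 < p (Suc n)")
    case True
    \<comment> \<open>Equality for \<open>n = 0\<close>; otherwise the right side is 0 and
      \<open>a n\<close> \<le> 0 \<le> \<open>y n\<close>.\<close>
    have "a n * y n \<le> a n * (if n = 0 then x else 0)"
      using a[of n] True yn(1) y0 by (auto simp: mult_nonpos_nonneg)
    then have "y (Suc n) \<le> bang_bang b p c a x (Suc n)"
      using True step yn by auto
    then show ?thesis
      unfolding Suc using True by (intro mult_left_mono) auto
  next
    case False
    then show ?thesis using Suc yn(2) by (simp add: mult_nonpos_nonneg)
  qed
qed

text \<open>Domination gives equality of the products with \<open>p t\<close>, and the price cancels
  because it is nonzero from index 1 on.\<close>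

lemma optimal_eq_bang_bang:
  assumes "ldo_lc b p c a" "strictly_alternating p" "x \<in> {0..b}"
    and y: "y \<in> optimal_trajectories b p c a x"
    and "\<And>n. n \<ge> 1 \<Longrightarrow> 0 < p (Suc n) \<Longrightarrow> a n \<le> 0"
    and "t \<ge> 1"
  shows "y t = bang_bang b p c a x t"
proof -
  have "y \<in> feasible b c a x"
    using y by (simp add: optimal_trajectories_def is_arg_max_def)
  then have "p t * y t = p t * bang_bang b p c a x t"
    using assms
    by (intro optimal_eq_dominating[OF _ y] bang_bang_feasible bang_bang_dominates)
      (auto simp: ldo_lc_def)
  then show ?thesis
    using strictly_alternating_nonzero[OF assms(2,6)] by simp
qed

theorem proposition8:
  fixes b x :: real and p c a y :: "nat \<Rightarrow> real"
  assumes "ldo_lc b p c a"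
    and "strictly_alternating p"
    and "\<forall>t. min (c t) (c t + a t * b) > 0"
    and "x \<in> {0..b}"
    and "y \<in> optimal_trajectories b p c a x"
  shows "(p 1 > 0 \<and> (\<forall>t\<ge>1. a (2 * t) \<le> 0) \<longrightarrow>
            (\<forall>t\<ge>1. y (2 * t) = 0) \<and>
            y 1 = min (c 0 + a 0 * x) b \<and>
            (\<forall>t>1. y (2 * t - 1) = min (c (2 * t - 2)) b)) \<and>
         (p 1 < 0 \<and> (\<forall>t\<ge>1. a (2 * t - 1) \<le> 0) \<longrightarrow>
            (\<forall>t\<ge>1. y (2 * t) = min (c (2 * t - 1)) b \<and> y (2 * t - 1) = 0))"
\<comment> \<open>The pattern restricts \<open>conjI\<close> to the conjunction of the two
  implications, leaving the conjunctions in their conclusions intact.\<close>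
proof (intro conjI[where P = "_ \<longrightarrow> _"] impI)
  note eq = optimal_eq_bang_bang[OF assms(1,2,4,5)]
  note signs = strictly_alternating_signs[OF assms(2)]
  {
    assume A: "p 1 > 0 \<and> (\<forall>t\<ge>1. a (2 * t) \<le> 0)"
    have "a n \<le> 0" if n: "n \<ge> 1" "0 < p (Suc n)" for n
    proof (cases "even n")
      case True
      then show ?thesis using A n by (auto elim!: evenE)
    next
      case False
      then obtain k where "n = Suc (2 * k)" by (auto elim: oddE)
      \<comment> \<open>Vacuous: for odd \<open>n\<close> the price at \<open>Suc n\<close> is not
        positive.\<close>
      then show ?thesis using A n signs(2)[of k] by auto
    qed
    note eq = eq[OF this]
    have even: "y (2 * t) = 0" if t1: "t \<ge> 1" for t
    proof -
      obtain k where t: "t = Suc k" using t1 by (cases t) auto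
      then show ?thesis using eq[of "2 * t"] signs(2)[of k] A by auto
    qed
    have one: "y 1 = min (c 0 + a 0 * x) b"
      using eq[of 1] A by simp
    have odd: "y (2 * t - 1) = min (c (2 * t - 2)) b" if t1: "t > 1" for t
    proof -
      obtain k where t: "t = Suc (Suc k)" using t1
        by (auto dest: less_imp_Suc_add)
      \<comment> \<open>Here \<open>2 * t - 1 = Suc (2 * Suc k)\<close>, whose predecessor is not 0,
        so the term with \<open>a\<close> drops out of the \<open>bang_bang\<close> value.\<close>
      have "0 < p (Suc (2 * Suc k))" using signs(1)[of "Suc k"] A by blast
      then show ?thesis using eq[of "Suc (2 * Suc k)"] by (simp add: t)
    qed
    show "(\<forall>t\<ge>1. y (2 * t) = 0) \<and> y 1 = min (c 0 + a 0 * x) b \<and>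
        (\<forall>t>1. y (2 * t - 1) = min (c (2 * t - 2)) b)"
      using even one odd by blast
  next
    assume A: "p 1 < 0 \<and> (\<forall>t\<ge>1. a (2 * t - 1) \<le> 0)"
    have "a n \<le> 0" if n: "n \<ge> 1" "0 < p (Suc n)" for n
    proof (cases "even n")
      case True
      then obtain k where "n = 2 * k" by (auto elim: evenE)
      \<comment> \<open>Now the even case is the vacuous one, and the odd case is the
        hypothesis.\<close>
      then show ?thesis using A n signs(1)[of k] by auto
    next
      case False
      then obtain k where "n = 2 * Suc k - 1" by (auto elim: oddE)
      then show ?thesis using A by auto
    qed
    note eq = eq[OF this]
    show "\<forall>t\<ge>1. y (2 * t) = min (c (2 * t - 1)) b \<and> y (2 * t - 1) = 0"
    proof (intro allI impI)
      fix t :: nat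
      assume "t \<ge> 1"
      then obtain k where t: "t = Suc k" by (cases t) auto
      \<comment> \<open>These are the prices at \<open>2 * t\<close> and \<open>2 * t - 1\<close>;
        the time before \<open>2 * t\<close> is at least 1, so only \<open>c\<close> remains in the
        bound.\<close>
      have "0 < p (Suc (Suc (2 * k)))" "\<not> 0 < p (Suc (2 * k))"
        using signs[of k] A by auto
      then show "y (2 * t) = min (c (2 * t - 1)) b \<and> y (2 * t - 1) = 0"
        using eq[of "Suc (Suc (2 * k))"] eq[of "Suc (2 * k)"] by (simp add: t)
    qed
  }
qed

end
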